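(* Let $L, n, K$ be integers with $2K \le n$, $L + 1 \le K$, and $L \ge 12 \ln(4n)$. Suppose $\mathcal{A}$ is an adversarially robust coloring algorithm for insert-only graph streams on the vertex set $[n]$ which works as long as the input graph has maximum degree at most $L$, and which maintains a coloring using at most $K$ colors such that, against any adaptive adversary, with probability at least $1/4$ all the colorings it reports are proper. Then $\mathcal{A}$ uses at least $C$ bits of space, where \[ C \ge \frac{1}{40 \ln 2}\cdot \frac{n L^2}{K} - 3. \]
   Context: An insert-only graph stream on vertex set $[n]$ is a sequence of edges (each edge appearing at most once), describing the graph formed by all edges inserted so far. A randomized streaming algorithm with $s$ bits of space and random string $R$ consists of an initial state (a function of $R$), a state-update function taking the current $s$-bit state, the next stream token and $R$ to a new $s$-bit state, and a query function taking the current state and $R$ to an output (here: an assignment of colors to the $n$ vertices). Adaptive adversary model: an adversary generates the stream token by token, where the $i$-th token is an arbitrary deterministic function of the outputs the algorithm gave to queries after each of the previous tokens (the adversary may query the algorithm after every token). A $K$-coloring output is proper if it uses at most $K$ colors and no edge of the current graph has both endpoints of the same color. The algorithm's space is the number of bits $s$ of its state. *)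

theory Defs
  imports "HOL-Probability.Probability"
begin

type_synonym edge = "nat set"

type_synonym coloring = "nat \<Rightarrow> nat"

definition edges_on :: "nat \<Rightarrow> edge set" where
  "edges_on n = {e. e \<subseteq> {1..n} \<and> card e = 2}"

text \<open>Colors are natural numbers. A coloring is \<^const>\<open>undefined\<close> outside the vertex set, so
  that it carries no information besides the colors of the vertices and the set of colorings is
  countable.\<close>

definition colorings :: "nat \<Rightarrow> coloring set" where
  "colorings n = {1..n} \<rightarrow>\<^sub>E UNIV"

definition valid_stream :: "nat \<Rightarrow> nat \<Rightarrow> edge list \<Rightarrow> bool" where
  "valid_stream n L es \<longleftrightarrow>
     distinct es \<and> set es \<subseteq> edges_on n \<and> (\<forall>v\<in>{1..n}. card {e \<in> set es. v \<in> e} \<le> L)"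

definition proper_coloring :: "nat \<Rightarrow> nat \<Rightarrow> edge set \<Rightarrow> coloring \<Rightarrow> bool" where
  "proper_coloring n K E c \<longleftrightarrow>
     card (c ` {1..n}) \<le> K \<and> (\<forall>u\<in>{1..n}. \<forall>v\<in>{1..n}. {u, v} \<in> E \<and> u \<noteq> v \<longrightarrow> c u \<noteq> c v)"

definition states :: "nat \<Rightarrow> bool list set" where
  "states s = {x. length x = s}"

record 'r stream_alg =
  init :: "'r \<Rightarrow> bool list"
  update :: "'r \<Rightarrow> bool list \<Rightarrow> edge \<Rightarrow> bool list"
  query :: "'r \<Rightarrow> bool list \<Rightarrow> coloring"

text \<open>The random string is drawn from an arbitrary probability space \<open>M\<close>. Each membership below
  states both that the values lie in the given countable set and that they are random variables.\<close>

definition streaming_algorithm :: "'r measure \<Rightarrow> nat \<Rightarrow> nat \<Rightarrow> 'r stream_alg \<Rightarrow> bool" where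
  "streaming_algorithm M n s A \<longleftrightarrow>
     prob_space M \<and>
     init A \<in> M \<rightarrow>\<^sub>M count_space (states s) \<and>
     (\<forall>x\<in>states s. \<forall>e\<in>edges_on n. (\<lambda>r. update A r x e) \<in> M \<rightarrow>\<^sub>M count_space (states s)) \<and>
     (\<forall>x\<in>states s. (\<lambda>r. query A r x) \<in> M \<rightarrow>\<^sub>M count_space (colorings n))"

text \<open>An adversary maps the list of the outputs seen so far, oldest first, to its next token;
  \<^const>\<open>None\<close> ends the stream.\<close>

type_synonym adversary = "coloring list \<Rightarrow> edge option"

definition adv_stream :: "adversary \<Rightarrow> coloring list \<Rightarrow> edge list" where
  "adv_stream adv cs = map (\<lambda>i. the (adv (take i cs))) [0..<length cs]"

text \<open>The stream has to meet the promise (simple graph, maximum degree at most \<open>L\<close>) whatever the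
  algorithm answers; an adversary can stop after answers for which it cannot keep the promise.\<close>

definition valid_adversary :: "nat \<Rightarrow> nat \<Rightarrow> adversary \<Rightarrow> bool" where
  "valid_adversary n L adv \<longleftrightarrow>
     (\<forall>cs. set cs \<subseteq> colorings n \<and> (\<forall>i<length cs. adv (take i cs) \<noteq> None) \<longrightarrow>
        valid_stream n L (adv_stream adv cs))"

text \<open>State, stream and list of outputs after (up to) \<open>i\<close> tokens, with a query after each token.\<close>

primrec interaction ::
  "'r stream_alg \<Rightarrow> adversary \<Rightarrow> 'r \<Rightarrow> nat \<Rightarrow> bool list \<times> edge list \<times> coloring list" where
  "interaction A adv r 0 = (init A r, [], [])"
| "interaction A adv r (Suc i) =
     (case interaction A adv r i of (x, es, cs) \<Rightarrow>
        (case adv cs of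
           None \<Rightarrow> (x, es, cs)
         | Some e \<Rightarrow>
             (let x' = update A r x e in (x', es @ [e], cs @ [query A r x']))))"

definition all_proper ::
  "nat \<Rightarrow> nat \<Rightarrow> 'r stream_alg \<Rightarrow> adversary \<Rightarrow> 'r \<Rightarrow> bool" where
  "all_proper n K A adv r \<longleftrightarrow>
     (\<forall>i. case interaction A adv r i of (x, es, cs) \<Rightarrow>
        \<forall>j<length cs. proper_coloring n K (set (take (Suc j) es)) (cs ! j))"

definition robust_coloring ::
  "'r measure \<Rightarrow> nat \<Rightarrow> nat \<Rightarrow> nat \<Rightarrow> real \<Rightarrow> 'r stream_alg \<Rightarrow> bool" where
  "robust_coloring M n L K p A \<longleftrightarrow>
     (\<forall>adv. valid_adversary n L adv \<longrightarrow> measure M {r \<in> space M. all_proper n K A adv r} \<ge> p)"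

end

theory Submission
  imports Defs "HOL-Combinatorics.Permutations"
begin

text \<open>
  Cut \<open>[n]\<close> into \<open>k = \<lceil>n / 3K\<rceil>\<close> blocks of \<open>N\<close> vertices, so that \<open>N / K\<close> lies between about \<open>3/2\<close> and
  \<open>3\<close>. The adversary first inserts a random graph: in every block, the edges \<open>{v, \<sigma> v}\<close> of \<open>q\<close>, about
  \<open>L / 4\<close>, independent uniform permutations, which have maximum degree \<open>2 q\<close>. From then on it
  greedily inserts pairs that lie in one block, have the same color in the last coloring and whose
  endpoints have received fewer than \<open>D2 = L - 2 q\<close> greedy edges. Proper colorings only reveal pairs
  that are not yet edges, and the greedy phase can only get stuck when at most \<open>K\<close> vertices of each
  block are unsaturated; so its edges \<open>F\<close> have degree sum at least \<open>D2 (N - K)\<close> in each block.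

  For a fixed random string, \<open>F\<close> is a function of the state after the first phase, hence takes at most
  \<open>2 ^ s\<close> values, and \<open>F\<close> is disjoint from the random graph. By the Bregman-Minc bound on permanents, a
  random permutation of a block avoids \<open>F\<close> with probability at most about
  \<open>exp (- D2 (N - K) / N)\<close>, and the union bound over the states gives
  \<open>1/4 \<le> 2 ^ s exp (- k q D2 (N - K) / N)\<close> up to a factor \<open>19/20\<close> in the exponent.
\<close>

section \<open>The Bregman-Minc inequality\<close>

text \<open>With as many rows as columns, the cardinality is the permanent of the 0/1 matrix whose
  row \<open>i\<close> has support \<open>H i\<close>. Arbitrary index sets allow minors without
  renumbering.\<close>

definition matchings :: "'a set \<Rightarrow> ('a \<Rightarrow> 'b set) \<Rightarrow> ('a \<Rightarrow> 'b) set" where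
  "matchings R H = {\<sigma> \<in> Pi\<^sub>E R H. inj_on \<sigma> R}"

text \<open>The logarithm of the \<open>r\<close>-th root of \<open>r!\<close>, the Bregman-Minc
  factor of a row with \<open>r\<close> ones.\<close>

definition ln_fact_mean :: "nat \<Rightarrow> real" where
  "ln_fact_mean r = ln (fact r) / real r"

lemma finite_matchings:
  assumes "finite R" "\<And>i. i \<in> R \<Longrightarrow> finite (H i)"
  shows "finite (matchings R H)"
  unfolding matchings_def using assms by (auto intro: finite_subset[OF _ finite_PiE])

text \<open>Expansion of the permanent along row \<open>i\<close>: the value \<open>k\<close> in
  that row leaves the minor without row \<open>i\<close> and column \<open>k\<close>.\<close>

lemma card_matchings_fixed:
  assumes "i \<in> R" "k \<in> H i"
  shows "card {\<sigma> \<in> matchings R H. \<sigma> i = k} = card (matchings (R - {i}) (\<lambda>j. H j - {k}))"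
proof -
  let ?f = "\<lambda>\<sigma>. restrict \<sigma> (R - {i})" and ?g = "\<lambda>\<tau>. \<tau>(i := k)"
  have "bij_betw ?f {\<sigma> \<in> matchings R H. \<sigma> i = k} (matchings (R - {i}) (\<lambda>j. H j - {k}))"
  proof (rule bij_betw_byWitness[where f' = ?g])
    show "\<forall>\<sigma>\<in>{\<sigma> \<in> matchings R H. \<sigma> i = k}. ?g (?f \<sigma>) = \<sigma>"
      using assms by (auto simp: matchings_def PiE_def extensional_def fun_eq_iff)
    show "\<forall>\<tau>\<in>matchings (R - {i}) (\<lambda>j. H j - {k}). ?f (?g \<tau>) = \<tau>"
      using assms by (auto simp: matchings_def PiE_def extensional_def fun_eq_iff)
    show "?f ` {\<sigma> \<in> matchings R H. \<sigma> i = k} \<subseteq> matchings (R - {i}) (\<lambda>j. H j - {k})"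
      using assms by (auto simp: matchings_def PiE_def Pi_def inj_on_def)
    show "?g ` matchings (R - {i}) (\<lambda>j. H j - {k}) \<subseteq> {\<sigma> \<in> matchings R H. \<sigma> i = k}"
    proof (rule image_subsetI)
      fix \<tau> assume "\<tau> \<in> matchings (R - {i}) (\<lambda>j. H j - {k})"
      then have \<tau>: "\<tau> \<in> Pi\<^sub>E (R - {i}) (\<lambda>j. H j - {k})" "inj_on \<tau> (R - {i})"
        by (auto simp: matchings_def)
      then have "\<tau>(i := k) \<in> Pi\<^sub>E R H" using assms by (auto simp: PiE_def extensional_def)
      moreover have "inj_on (\<tau>(i := k)) (insert i (R - {i}))"
        unfolding inj_on_insert using \<tau> by (auto simp: inj_on_def)
      ultimately show "\<tau>(i := k) \<in> {\<sigma> \<in> matchings R H. \<sigma> i = k}"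
        using assms by (simp add: matchings_def insert_absorb)
    qed
  qed
  then show ?thesis by (rule bij_betw_same_card)
qed

text \<open>Convexity of \<open>x ln x\<close>, obtained from \<open>ln x \<le> x - 1\<close> at the
  ratio of the mean of \<open>t\<close> to \<open>t k\<close>.\<close>

lemma sum_mult_ln_le:
  fixes t :: "'a \<Rightarrow> nat"
  assumes "finite S" "S \<noteq> {}"
  defines "P \<equiv> \<Sum>k\<in>S. t k"
  shows "real P * ln P \<le> real P * ln (card S) + (\<Sum>k\<in>S. real (t k) * ln (t k))"
proof (cases "P = 0")
  case True
  then have "\<forall>k\<in>S. t k = 0" using assms by (simp add: P_def)
  with True show ?thesis by simp
next
  case False
  have r: "real (card S) > 0" using assms by (simp add: card_gt_0_iff)
  have P: "real P > 0" using False by simp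
  have "real (t k) * (ln P - ln (card S) - ln (t k)) \<le> P / card S - t k" if "k \<in> S" for k
  proof (cases "t k = 0")
    case False
    then have "ln P - ln (card S) - ln (t k) = ln (P / (card S * t k))"
      using P r by (simp add: ln_div ln_mult)
    also have "\<dots> \<le> P / (card S * t k) - 1"
      using P r False by (intro ln_le_minus_one) auto
    finally have "real (t k) * (ln P - ln (card S) - ln (t k)) \<le> t k * (P / (card S * t k) - 1)"
      by (intro mult_left_mono) auto
    also have "\<dots> = P / card S - t k" using False r by (simp add: field_simps)
    finally show ?thesis .
  qed (use P r in auto)
  then have "(\<Sum>k\<in>S. real (t k) * (ln P - ln (card S) - ln (t k))) \<le> (\<Sum>k\<in>S. P / card S - t k)"
    by (rule sum_mono)
  also have "\<dots> = 0" using r by (simp add: sum_subtractf P_def)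
  also have "(\<Sum>k\<in>S. real (t k) * (ln P - ln (card S) - ln (t k)))
      = real P * ln P - real P * ln (card S) - (\<Sum>k\<in>S. real (t k) * ln (t k))"
    by (simp add: P_def sum_subtractf right_diff_distrib sum_distrib_right)
  finally show ?thesis by simp
qed

text \<open>This is \<open>ln (r!) = ln r + ln ((r - 1)!)\<close>. The case \<open>r = 1\<close> is
  separate because \<open>ln_fact_mean 0\<close> divides by zero.\<close>

lemma ln_fact_mean_step:
  assumes "r > 0"
  shows "ln r + (real r - 1) * ln_fact_mean (r - 1) = real r * ln_fact_mean r"
proof (cases "r = 1")
  case False
  then obtain m where "r = Suc m" "m > 0" using assms by (cases r) auto
  then show ?thesis by (simp add: ln_fact_mean_def ln_mult)
qed (simp add: ln_fact_mean_def)

text \<open>Schrijver's proof, in logarithmic form: expand \<open>P ln P\<close> along every row by convexity, and sum the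
  induction hypotheses for the minors over all rows and matchings.\<close>

theorem bregman_minc:
  assumes "finite C" "finite R" "card R = card C" "\<And>j. j \<in> R \<Longrightarrow> H j \<subseteq> C" "matchings R H \<noteq> {}"
  shows "ln (card (matchings R H)) \<le> (\<Sum>j\<in>R. ln_fact_mean (card (H j)))"
  using assms
proof (induction "card R" arbitrary: R C H)
  case 0
  then have "R = {}" by simp
  then show ?case by (simp add: matchings_def)
next
  case (Suc m)
  define S where "S = matchings R H"
  define t where "t i k = card {\<sigma> \<in> S. \<sigma> i = k}" for i k
  define P where "P = card S"
  have finH: "finite (H j)" if "j \<in> R" for j
    using Suc.prems that finite_subset by metis
  have finS: "finite S" unfolding S_def using Suc.prems finH by (intro finite_matchings) auto
  have P: "real P > 0" using Suc.prems finS by (simp add: P_def S_def card_gt_0_iff)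
  have SH: "\<sigma> i \<in> H i" if "\<sigma> \<in> S" "i \<in> R" for \<sigma> i
    using that by (auto simp: S_def matchings_def)
  have Pt: "P = (\<Sum>k\<in>H i. t i k)" if "i \<in> R" for i
  proof -
    have "S = (\<Union>k\<in>H i. {\<sigma> \<in> S. \<sigma> i = k})" using SH that by auto
    then have "P = card (\<Union>k\<in>H i. {\<sigma> \<in> S. \<sigma> i = k})" by (simp add: P_def)
    also have "\<dots> = (\<Sum>k\<in>H i. t i k)"
      unfolding t_def using finS finH[OF that] by (intro card_UN_disjoint) auto
    finally show ?thesis .
  qed
  \<comment> \<open>Summing over all matchings meets the value \<open>k\<close> in row
    \<open>i\<close> exactly \<open>t i k\<close> times, which produces the right-hand side of the
    convexity inequality.\<close>
  have row: "real P * ln P \<le> (\<Sum>\<sigma>\<in>S. ln (card (H i)) + ln (t i (\<sigma> i)))" if i: "i \<in> R" for i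
  proof -
    have ne: "H i \<noteq> {}" using Suc.prems(5) SH i by (auto simp: S_def)
    have "(\<Sum>\<sigma>\<in>S. ln (real (t i (\<sigma> i)))) = (\<Sum>k\<in>H i. \<Sum>\<sigma> | \<sigma> \<in> S \<and> \<sigma> i = k. ln (real (t i (\<sigma> i))))"
      using finS finH[OF i] SH i by (intro sum.group[symmetric]) auto
    also have "\<dots> = (\<Sum>k\<in>H i. real (t i k) * ln (t i k))"
      by (intro sum.cong) (auto simp: t_def)
    finally have "(\<Sum>\<sigma>\<in>S. ln (card (H i)) + ln (t i (\<sigma> i)))
        = real P * ln (card (H i)) + (\<Sum>k\<in>H i. real (t i k) * ln (t i k))"
      by (simp add: sum.distrib P_def)
    with sum_mult_ln_le[OF finH[OF i] ne, of "t i"] Pt[OF i] show ?thesis by simp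
  qed
  \<comment> \<open>The rest of \<open>\<sigma>\<close> is a matching of this minor, so the
    induction hypothesis applies to it.\<close>
  have minor: "ln (t i (\<sigma> i)) \<le> (\<Sum>j\<in>R - {i}. ln_fact_mean (card (H j - {\<sigma> i})))"
    if i: "i \<in> R" and \<sigma>: "\<sigma> \<in> S" for i \<sigma>
  proof -
    have eq: "t i (\<sigma> i) = card (matchings (R - {i}) (\<lambda>j. H j - {\<sigma> i}))"
      unfolding t_def S_def using SH[OF \<sigma> i] i by (intro card_matchings_fixed)
    have "t i (\<sigma> i) \<noteq> 0" unfolding t_def using \<sigma> finS by auto
    then have "matchings (R - {i}) (\<lambda>j. H j - {\<sigma> i}) \<noteq> {}" using eq by auto
    moreover have "\<sigma> i \<in> C" using SH[OF \<sigma> i] Suc.prems(4) i by auto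
    ultimately show ?thesis unfolding eq
      using Suc.prems Suc.hyps(2) i by (intro Suc.hyps(1)[of "R - {i}" "C - {\<sigma> i}"]) auto
  qed
  have total: "(\<Sum>i\<in>R. ln (card (H i)) + ln (t i (\<sigma> i)))
      \<le> real (card R) * (\<Sum>j\<in>R. ln_fact_mean (card (H j)))" if \<sigma>: "\<sigma> \<in> S" for \<sigma>
  proof -
    have inj: "inj_on \<sigma> R" using \<sigma> by (auto simp: S_def matchings_def)
    have sub: "\<sigma> ` R \<subseteq> C" using SH[OF \<sigma>] Suc.prems(4) by auto
    have surj: "\<sigma> ` R = C"
      using Suc.prems(1,3) sub card_image[OF inj] by (intro card_subset_eq) auto
    \<comment> \<open>As \<open>\<sigma>\<close> is onto \<open>C\<close>, exactly
      \<open>card (H j)\<close> rows \<open>i\<close> have \<open>\<sigma> i\<close> in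
      \<open>H j\<close>, and \<open>j\<close> is one of them. Deleting the columns of the others
      shortens row \<open>j\<close> by one; all remaining columns leave it unchanged.\<close>
    have col: "ln (card (H j)) + (\<Sum>i\<in>R - {j}. ln_fact_mean (card (H j - {\<sigma> i})))
        = real (card R) * ln_fact_mean (card (H j))" if j: "j \<in> R" for j
    proof -
      let ?r = "card (H j)" and ?I = "{i \<in> R. \<sigma> i \<in> H j}"
      have rpos: "?r > 0" using SH[OF \<sigma> j] finH[OF j] by (auto simp: card_gt_0_iff)
      have "\<sigma> ` ?I = H j" using surj Suc.prems(4)[OF j] by auto
      then have cI: "card ?I = ?r"
        using card_image[OF inj_on_subset[OF inj, of ?I]] by auto
      have jI: "j \<in> ?I" using j SH[OF \<sigma> j] by auto
      have fI: "finite ?I" using Suc.prems(2) by auto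
      have "(\<Sum>i\<in>R - {j}. ln_fact_mean (card (H j - {\<sigma> i})))
          = (\<Sum>i\<in>R - {j}. if i \<in> ?I then ln_fact_mean (?r - 1) else ln_fact_mean ?r)"
        by (intro sum.cong) auto
      also have "\<dots> = (\<Sum>i\<in>(R - {j}) \<inter> ?I. ln_fact_mean (?r - 1)) + (\<Sum>i\<in>(R - {j}) \<inter> - ?I. ln_fact_mean ?r)"
        using Suc.prems(2) by (subst sum.If_cases) auto
      also have "(R - {j}) \<inter> ?I = ?I - {j}" by auto
      also have "(R - {j}) \<inter> - ?I = R - ?I" using jI by auto
      finally have "(\<Sum>i\<in>R - {j}. ln_fact_mean (card (H j - {\<sigma> i})))
          = real (card (?I - {j})) * ln_fact_mean (?r - 1) + real (card (R - ?I)) * ln_fact_mean ?r"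
        by simp
      moreover have "real (card (?I - {j})) = real ?r - 1"
        using jI fI cI rpos by (simp add: card_Diff_singleton of_nat_diff)
      moreover have "real (card (R - ?I)) = real (card R) - real ?r"
      proof -
        have "card (R - ?I) = card R - card ?I" using fI by (intro card_Diff_subset) auto
        moreover have "card ?I \<le> card R" using Suc.prems(2) by (intro card_mono) auto
        ultimately show ?thesis using cI by (simp add: of_nat_diff)
      qed
      ultimately show ?thesis using ln_fact_mean_step[OF rpos] by (simp add: algebra_simps)
    qed
    have "(\<Sum>i\<in>R. ln (card (H i)) + ln (t i (\<sigma> i)))
        \<le> (\<Sum>i\<in>R. ln (card (H i)) + (\<Sum>j\<in>R - {i}. ln_fact_mean (card (H j - {\<sigma> i}))))"
      using minor[OF _ \<sigma>] by (intro sum_mono) auto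
    also have "\<dots> = (\<Sum>i\<in>R. ln (card (H i)))
        + (\<Sum>i\<in>R. \<Sum>j\<in>{j \<in> R. i \<noteq> j}. ln_fact_mean (card (H j - {\<sigma> i})))"
      unfolding sum.distrib by (intro arg_cong2[where f="(+)"] sum.cong) auto
    \<comment> \<open>The exchange collects, for each row \<open>j\<close>, all the minors in which
      it survives, as \<open>col\<close> requires.\<close>
    also have "(\<Sum>i\<in>R. \<Sum>j\<in>{j \<in> R. i \<noteq> j}. ln_fact_mean (card (H j - {\<sigma> i})))
        = (\<Sum>j\<in>R. \<Sum>i\<in>{i \<in> R. i \<noteq> j}. ln_fact_mean (card (H j - {\<sigma> i})))"
      using Suc.prems(2) by (intro sum.swap_restrict) auto
    also have "(\<Sum>i\<in>R. ln (card (H i))) + \<dots>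
        = (\<Sum>j\<in>R. ln (card (H j)) + (\<Sum>i\<in>R - {j}. ln_fact_mean (card (H j - {\<sigma> i}))))"
      unfolding sum.distrib by (intro arg_cong2[where f="(+)"] sum.cong) auto
    also have "\<dots> = real (card R) * (\<Sum>j\<in>R. ln_fact_mean (card (H j)))"
      using col by (simp add: sum_distrib_left)
    finally show ?thesis .
  qed
  have "real (card R) * (real P * ln P) \<le> (\<Sum>i\<in>R. \<Sum>\<sigma>\<in>S. ln (card (H i)) + ln (t i (\<sigma> i)))"
    using sum_mono[of R "\<lambda>_. real P * ln P", OF row] by simp
  also have "\<dots> = (\<Sum>\<sigma>\<in>S. \<Sum>i\<in>R. ln (card (H i)) + ln (t i (\<sigma> i)))"
    by (rule sum.swap)
  also have "\<dots> \<le> (\<Sum>\<sigma>\<in>S. real (card R) * (\<Sum>j\<in>R. ln_fact_mean (card (H j))))"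
    using total by (intro sum_mono)
  also have "\<dots> = real (card R) * (real P * (\<Sum>j\<in>R. ln_fact_mean (card (H j))))"
    by (simp add: P_def)
  finally have "ln P \<le> (\<Sum>j\<in>R. ln_fact_mean (card (H j)))"
    using P Suc.hyps(2) by (simp add: mult_le_cancel_left)
  then show ?case by (simp add: P_def S_def)
qed

section \<open>Growth of \<open>ln_fact_mean\<close> and permutations that avoid a graph\<close>

lemma ln_fact_le:
  assumes "r > 0"
  shows "(\<Sum>j=1..<r. 1 - 1 / (2 * real j + 1)) \<le> (real r - 1) * ln r - ln (fact (r - 1))"
  using assms
proof (induction r rule: nat_induct_non_zero)
  case (Suc r)
  \<comment> \<open>Passing from \<open>r\<close> to \<open>r + 1\<close> increases the right-hand
    side by \<open>r (ln (r + 1) - ln r)\<close>, and this bound on the logarithm shows that the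
    increase is at least the new summand.\<close>
  have "ln (real r + 1) - ln (real r) \<ge> 2 * ((real r + 1) - real r) / (real r + (real r + 1))"
    using Suc.hyps by (intro ln_inverse_approx_ge) auto
  then have "real r * (ln (real r + 1) - ln (real r)) \<ge> real r * (2 / (2 * real r + 1))"
    by (intro mult_left_mono) auto
  moreover have "real r * (2 / (2 * real r + 1)) = 1 - 1 / (2 * real r + 1)"
    using Suc.hyps by (simp add: field_simps)
  moreover have "ln (fact r) = ln (real r) + ln (fact (r - 1))"
    using Suc.hyps by (simp add: fact_reduce ln_mult)
  moreover have "(\<Sum>j=1..<Suc r. 1 - 1 / (2 * real j + 1))
      = (\<Sum>j=1..<r. 1 - 1 / (2 * real j + 1)) + (1 - 1 / (2 * real r + 1))"
    using Suc.hyps by simp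
  ultimately show ?case using Suc.IH by (simp add: algebra_simps)
qed simp

text \<open>From \<open>r = 20\<close> on each new summand is at least \<open>39/40\<close>; the
  constant \<open>11/10\<close> covers the deficit of the earlier ones.\<close>

lemma sum_one_minus_inverse_odd_ge:
  assumes "r \<ge> 20"
  shows "39/40 * (real r - 1) - 11/10 \<le> (\<Sum>j=1..<r. 1 - 1 / (2 * real j + 1))"
  using assms
proof (induction r rule: dec_induct)
  case base
  show ?case by (simp add: eval_nat_numeral)
next
  case (step r)
  have "1 / (2 * real r + 1) \<le> 1 / 40" using step.hyps by (simp add: field_simps)
  moreover have "(\<Sum>j=1..<Suc r. 1 - 1 / (2 * real j + 1))
      = (\<Sum>j=1..<r. 1 - 1 / (2 * real j + 1)) + (1 - 1 / (2 * real r + 1))"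
    using step.hyps by simp
  moreover have "39/40 * (real (Suc r) - 1) = 39/40 * (real r - 1) + 39/40" by (simp add: field_simps)
  ultimately show ?case using step.IH by linarith
qed

text \<open>The difference equals \<open>((r - 1) ln r - ln ((r - 1)!)) / (r (r - 1))\<close>.
  Lowering \<open>39/40\<close> to \<open>19/20\<close> gains \<open>(r - 1) / 40\<close>, which
  exceeds \<open>11/10\<close> in this range.\<close>

lemma ln_fact_mean_diff_ge:
  assumes "r \<ge> 70"
  shows "19/20 / real r \<le> ln_fact_mean r - ln_fact_mean (r - 1)"
proof -
  have "19/20 * (real r - 1) \<le> (real r - 1) * ln r - ln (fact (r - 1))"
  proof -
    have "19/20 * (real r - 1) \<le> 39/40 * (real r - 1) - 11/10" using assms by simp
    also have "\<dots> \<le> (\<Sum>j=1..<r. 1 - 1 / (2 * real j + 1))"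
      using assms by (intro sum_one_minus_inverse_odd_ge) auto
    also have "\<dots> \<le> (real r - 1) * ln r - ln (fact (r - 1))"
      using assms by (intro ln_fact_le) auto
    finally show ?thesis .
  qed
  then have "19/20 * (real r - 1) / (r * (real r - 1)) \<le> ((real r - 1) * ln r - ln (fact (r - 1))) / (r * (real r - 1))"
    using assms by (intro divide_right_mono) auto
  also have "\<dots> = ln_fact_mean r - ln_fact_mean (r - 1)"
  proof -
    have "ln (fact r) = ln (real r) + ln (fact (r - 1))"
      using assms by (simp add: fact_reduce ln_mult)
    moreover have "real (r - 1) = real r - 1" using assms by simp
    ultimately show ?thesis using assms by (simp add: ln_fact_mean_def field_simps)
  qed
  also have "19/20 * (real r - 1) / (r * (real r - 1)) = 19/20 / r"
    using assms by (simp add: divide_simps)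
  finally show ?thesis .
qed

text \<open>Telescoping: each of the \<open>f\<close> decrements starts from a size of at most
  \<open>N\<close>, so it loses at least \<open>19/20 / N\<close>.\<close>

lemma ln_fact_mean_diff_ge':
  assumes "f \<le> N" "N - f \<ge> 70"
  shows "ln_fact_mean (N - f) \<le> ln_fact_mean N - 19/20 * real f / real N"
  using assms
proof (induction f)
  case (Suc f)
  have "19/20 / real N \<le> 19/20 / real (N - f)"
    using Suc.prems by (intro divide_left_mono) auto
  also have "\<dots> \<le> ln_fact_mean (N - f) - ln_fact_mean (N - f - 1)"
    using Suc.prems by (intro ln_fact_mean_diff_ge) auto
  finally have "19/20 / real N \<le> ln_fact_mean (N - f) - ln_fact_mean (N - Suc f)" by simp
  moreover have "ln_fact_mean (N - f) \<le> ln_fact_mean N - 19/20 * real f / real N"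
    using Suc by simp
  moreover have "19/20 * real (Suc f) / real N = 19/20 * real f / real N + 19/20 / real N"
    by (simp add: add_divide_distrib)
  ultimately show ?case by linarith
qed simp

text \<open>In the Bregman-Minc bound full rows would contribute exactly \<open>(card B)!\<close>,
  and each forbidden value lowers the logarithm by at least \<open>19/20 / card B\<close>. The
  margin 70 keeps all row sizes within the range of that estimate.\<close>

lemma card_permutations_avoiding_le:
  fixes d :: "'a \<Rightarrow> nat"
  assumes "finite B" "\<And>v. v \<in> B \<Longrightarrow> card {u \<in> B. Q v u} = d v" "\<And>v. v \<in> B \<Longrightarrow> d v + 70 \<le> card B"
  shows "real (card {\<sigma>. \<sigma> permutes B \<and> (\<forall>v\<in>B. \<not> Q v (\<sigma> v))})
    \<le> fact (card B) * exp (- (19/20 * real (\<Sum>v\<in>B. d v) / real (card B)))"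
    (is "real (card ?S) \<le> _")
proof -
  define H where "H v = {u \<in> B. \<not> Q v u}" for v
  have cH: "card (H v) = card B - d v" if "v \<in> B" for v
  proof -
    have "H v = B - {u \<in> B. Q v u}" by (auto simp: H_def)
    then show ?thesis using assms(1) assms(2)[OF that] by (simp add: card_Diff_subset)
  qed
  have "inj_on (\<lambda>\<sigma>. restrict \<sigma> B) ?S"
  proof (rule inj_onI)
    fix \<sigma> \<tau> assume *: "\<sigma> \<in> ?S" "\<tau> \<in> ?S" "restrict \<sigma> B = restrict \<tau> B"
    show "\<sigma> = \<tau>"
    proof
      fix x show "\<sigma> x = \<tau> x"
        using * by (cases "x \<in> B") (auto simp: permutes_not_in dest: fun_cong[of _ _ x])
    qed
  qed
  moreover have "(\<lambda>\<sigma>. restrict \<sigma> B) ` ?S \<subseteq> matchings B H"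
    by (auto simp: matchings_def H_def permutes_in_image inj_on_def dest: permutes_inj)
  moreover have fin: "finite (matchings B H)"
    using assms(1) by (intro finite_matchings) (auto simp: H_def)
  ultimately have le: "card ?S \<le> card (matchings B H)" by (rule card_inj_on_le)
  show ?thesis
  proof (cases "matchings B H = {}")
    case False
    have "ln (card (matchings B H)) \<le> (\<Sum>v\<in>B. ln_fact_mean (card (H v)))"
      using assms(1) False by (intro bregman_minc[of B]) (auto simp: H_def)
    also have "\<dots> \<le> (\<Sum>v\<in>B. ln_fact_mean (card B) - 19/20 * real (d v) / real (card B))"
    proof (rule sum_mono)
      fix v assume "v \<in> B"
      then show "ln_fact_mean (card (H v)) \<le> ln_fact_mean (card B) - 19/20 * real (d v) / real (card B)"
        using assms(3)[of v] cH[of v] ln_fact_mean_diff_ge'[of "d v" "card B"] by simp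
    qed
    also have "\<dots> = ln (fact (card B)) - 19/20 * real (\<Sum>v\<in>B. d v) / real (card B)"
      by (cases "card B = 0")
         (auto simp: sum_subtractf ln_fact_mean_def sum_distrib_left sum_divide_distrib)
    finally have "exp (ln (card (matchings B H))) \<le> exp \<dots>" by simp
    moreover have "exp (ln (card (matchings B H))) = real (card (matchings B H))"
      using False fin by (simp add: card_gt_0_iff)
    ultimately have "real (card (matchings B H))
        \<le> exp (ln (fact (card B)) - 19/20 * real (\<Sum>v\<in>B. d v) / real (card B))" by simp
    also have "\<dots> = fact (card B) * exp (- (19/20 * real (\<Sum>v\<in>B. d v) / real (card B)))"
      by (simp add: exp_diff exp_minus field_simps)
    finally show ?thesis using le by linarith
  qed (use le in simp)
qed

section \<open>Greedy adversaries\<close>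

definition edge_deg :: "edge set \<Rightarrow> nat \<Rightarrow> nat" where
  "edge_deg E v = card {e \<in> E. v \<in> e}"

lemma edge_deg_empty [simp]: "edge_deg {} v = 0"
  by (simp add: edge_deg_def)

lemma edge_deg_insert:
  assumes "finite E" "e \<notin> E"
  shows "edge_deg (insert e E) v = (if v \<in> e then Suc (edge_deg E v) else edge_deg E v)"
proof -
  have "{e' \<in> insert e E. v \<in> e'} = (if v \<in> e then insert e {e' \<in> E. v \<in> e'} else {e' \<in> E. v \<in> e'})"
    by auto
  then show ?thesis using assms by (simp add: edge_deg_def)
qed

lemma edge_deg_mono: "finite E' \<Longrightarrow> E \<subseteq> E' \<Longrightarrow> edge_deg E v \<le> edge_deg E' v"
  unfolding edge_deg_def by (intro card_mono) auto

lemma edge_deg_Un_le: "edge_deg (E \<union> E') v \<le> edge_deg E v + edge_deg E' v"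
proof -
  have "{e \<in> E \<union> E'. v \<in> e} = {e \<in> E. v \<in> e} \<union> {e \<in> E'. v \<in> e}" by auto
  then show ?thesis by (simp add: edge_deg_def card_Un_le)
qed

lemma finite_edges_on: "finite (edges_on n)"
  unfolding edges_on_def by (rule finite_subset[of _ "Pow {1..n}"]) auto

lemma valid_stream_prefix: "valid_stream n L (xs @ ys) \<Longrightarrow> valid_stream n L xs"
  unfolding valid_stream_def edge_deg_def[symmetric]
  by (auto intro: order_trans[OF edge_deg_mono])

text \<open>An adversary may as well look at the stream that it has produced so far.\<close>

primrec rev_tokens :: "(edge list \<Rightarrow> coloring list \<Rightarrow> edge option) \<Rightarrow> coloring list \<Rightarrow> edge list" where
  "rev_tokens step [] = []"
| "rev_tokens step (c # cs) = rev_tokens step cs @ [the (step (rev_tokens step cs) (rev cs))]"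

text \<open>The outputs determine the stream, because earlier tokens can be recomputed from them.
  \<open>rev_tokens\<close> recurses on the list with the newest output first, hence the
  reversal.\<close>

definition adv_of :: "(edge list \<Rightarrow> coloring list \<Rightarrow> edge option) \<Rightarrow> adversary" where
  "adv_of step cs = step (rev_tokens step (rev cs)) cs"

lemma adv_stream_snoc: "adv_stream adv (cs @ [c]) = adv_stream adv cs @ [the (adv cs)]"
  by (simp add: adv_stream_def)

lemma adv_of_eq: "adv_of step cs = step (adv_stream (adv_of step) cs) cs"
proof -
  have "adv_stream (adv_of step) cs = rev_tokens step (rev cs)"
    by (induction cs rule: rev_induct) (simp_all add: adv_stream_snoc adv_of_def, simp add: adv_stream_def)
  then show ?thesis by (simp add: adv_of_def)
qed

text \<open>Validity of the stream after the latest token is all that must be checked, so it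
  suffices that \<open>step\<close> never issues a token that breaks the promise.\<close>

lemma valid_adversary_adv_of:
  assumes "\<And>es cs e. step es cs = Some e \<Longrightarrow> valid_stream n L (es @ [e])"
  shows "valid_adversary n L (adv_of step)"
  unfolding valid_adversary_def
proof (intro allI impI)
  fix cs assume "set cs \<subseteq> colorings n \<and> (\<forall>i<length cs. adv_of step (take i cs) \<noteq> None)"
  then have "\<forall>i<length cs. adv_of step (take i cs) \<noteq> None" by simp
  then show "valid_stream n L (adv_stream (adv_of step) cs)"
  proof (induction cs rule: rev_induct)
    case Nil
    show ?case by (simp add: adv_stream_def valid_stream_def)
  next
    case (snoc c cs)
    then have "adv_of step cs \<noteq> None" by (auto dest: spec[of _ "length cs"])
    then show ?case using assms adv_of_eq[of step cs] by (auto simp: adv_stream_snoc)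
  qed
qed

lemma interaction_adv_stream:
  "interaction A adv r i = (x, es, cs) \<Longrightarrow> es = adv_stream adv cs \<and> length es = length cs"
proof (induction i arbitrary: x es cs)
  case 0
  then show ?case by (simp add: adv_stream_def)
next
  case (Suc i)
  obtain x' es' cs' where i: "interaction A adv r i = (x', es', cs')" by (metis prod_cases3)
  show ?case using Suc.prems Suc.IH[OF i] i
    by (auto simp: adv_stream_snoc Let_def split: option.splits)
qed

lemma interaction_adv_of_Suc:
  assumes "interaction A (adv_of step) r i = (x, es, cs)"
  shows "interaction A (adv_of step) r (Suc i) = (case step es cs of
           None \<Rightarrow> (x, es, cs)
         | Some e \<Rightarrow> (update A r x e, es @ [e], cs @ [query A r (update A r x e)]))"
proof -
  have "adv_of step cs = step es cs"
    using interaction_adv_stream[OF assms] adv_of_eq[of step cs] by simp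
  then show ?thesis using assms by (simp add: Let_def split: option.split)
qed

lemma all_proper_last:
  assumes "all_proper n K A adv r" "interaction A adv r i = (x, es, cs)" "cs \<noteq> []"
  shows "proper_coloring n K (set es) (last cs)"
proof -
  have "\<forall>j<length cs. proper_coloring n K (set (take (Suc j) es)) (cs ! j)"
    using assms(1)[unfolded all_proper_def, rule_format, of i] assms(2) by simp
  from this[rule_format, of "length cs - 1"]
  have "proper_coloring n K (set (take (length cs) es)) (last cs)"
    using assms(3) by (simp add: last_conv_nth)
  moreover have "take (length cs) es = es" using conjunct2[OF interaction_adv_stream[OF assms(2)]] by simp
  ultimately show ?thesis by simp
qed

section \<open>The two-phase adversary and its greedy phase\<close>

locale block_game =
  fixes n L K D1 D2 :: nat and \<B> :: "nat set set"
  assumes degs: "D1 + D2 \<le> L"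
    and blocks: "disjoint \<B>" "\<And>B. B \<in> \<B> \<Longrightarrow> B \<subseteq> {1..n}"
begin

text \<open>The edges of the first phase do not enter: the greedy move depends only on the greedy
  edges so far and on the current coloring. This makes the second phase a function of the
  algorithm's state.\<close>

definition candidate :: "edge list \<Rightarrow> coloring \<Rightarrow> edge \<Rightarrow> bool" where
  "candidate F c e \<longleftrightarrow> (\<exists>B\<in>\<B>. \<exists>u\<in>B. \<exists>v\<in>B. u \<noteq> v \<and> e = {u, v} \<and> c u = c v \<and>
     edge_deg (set F) u < D2 \<and> edge_deg (set F) v < D2)"

definition greedy :: "edge list \<Rightarrow> coloring \<Rightarrow> edge option" where
  "greedy F c = (if \<exists>e. candidate F c e then Some (SOME e. candidate F c e) else None)"

lemma greedy_Some: "greedy F c = Some e \<Longrightarrow> candidate F c e"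
  unfolding greedy_def by (auto split: if_splits intro: someI)

lemma greedy_None: "greedy F c = None \<Longrightarrow> \<not> candidate F c e"
  unfolding greedy_def by (auto split: if_splits)

text \<open>The tokens of \<open>gs\<close> come first, then greedy moves. The validity test keeps
  the promise even against improper answers; \<open>robust_run\<close> shows that it always passes
  when the answers are proper.\<close>

definition next_token :: "edge list \<Rightarrow> edge list \<Rightarrow> coloring list \<Rightarrow> edge option" where
  "next_token gs es cs =
     (case (if length es < length gs then Some (gs ! length es)
            else greedy (drop (length gs) es) (last cs)) of
        None \<Rightarrow> None
      | Some e \<Rightarrow> if valid_stream n L (es @ [e]) then Some e else None)"

lemma valid_adversary_next_token: "valid_adversary n L (adv_of (next_token gs))"
  by (rule valid_adversary_adv_of) (auto simp: next_token_def split: option.splits if_splits)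

text \<open>The second phase replayed from a state \<open>x\<close> without knowledge of the first.
  For fixed \<open>r\<close> its result therefore takes at most as many values as there are
  states.\<close>

primrec greedy_run :: "'r stream_alg \<Rightarrow> 'r \<Rightarrow> bool list \<Rightarrow> nat \<Rightarrow> bool list \<times> edge list" where
  "greedy_run A r x 0 = (x, [])"
| "greedy_run A r x (Suc j) = (case greedy_run A r x j of (y, F) \<Rightarrow>
     (case greedy F (query A r y) of
        None \<Rightarrow> (y, F)
      | Some e \<Rightarrow> (update A r y e, F @ [e])))"

text \<open>Once stuck, the run stays stuck, so a run that can still move has gained an edge in
  every round.\<close>

lemma length_greedy_run:
  assumes "greedy_run A r x j = (y, F)" "greedy F (query A r y) \<noteq> None"
  shows "length F = j"
  using assms
proof (induction j arbitrary: y F)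
  case (Suc j)
  obtain y' F' where j: "greedy_run A r x j = (y', F')" by fastforce
  show ?case
  proof (cases "greedy F' (query A r y')")
    case None
    then show ?thesis using Suc.prems j by auto
  next
    case (Some e)
    then show ?thesis using Suc j by auto
  qed
qed simp

definition saturating :: "edge set \<Rightarrow> bool" where
  "saturating F \<longleftrightarrow> finite F \<and> (\<forall>e\<in>F. card e = 2 \<and> (\<exists>B\<in>\<B>. e \<subseteq> B)) \<and>
     (\<forall>v. edge_deg F v \<le> D2) \<and> (\<forall>B\<in>\<B>. D2 * (card B - K) \<le> (\<Sum>v\<in>B. edge_deg F v))"

text \<open>Two unsaturated vertices of a block with the same color would form a candidate. Hence
  the unsaturated ones have distinct colors, and there are at most \<open>K\<close> of them.\<close>

lemma saturating_if_stuck: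
  assumes "proper_coloring n K E c" "greedy F c = None"
    and "\<forall>e\<in>set F. card e = 2 \<and> (\<exists>B\<in>\<B>. e \<subseteq> B)" "\<forall>v. edge_deg (set F) v \<le> D2"
  shows "saturating (set F)"
  unfolding saturating_def
proof (intro conjI ballI)
  fix B assume B: "B \<in> \<B>"
  let ?U = "{v \<in> B. edge_deg (set F) v < D2}"
  have fB: "finite B" using blocks(2)[OF B] finite_subset by blast
  have "inj_on c ?U"
  proof (rule inj_onI, rule ccontr)
    fix u v assume *: "u \<in> ?U" "v \<in> ?U" "c u = c v" "u \<noteq> v"
    then have "candidate F c {u, v}" unfolding candidate_def using B by blast
    then show False using greedy_None[OF assms(2)] by blast
  qed
  then have "card ?U = card (c ` ?U)" by (simp add: card_image)
  also have "\<dots> \<le> card (c ` {1..n})" using blocks(2)[OF B] by (intro card_mono) auto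
  also have "\<dots> \<le> K" using assms(1) by (simp add: proper_coloring_def)
  finally have U: "card ?U \<le> K" .
  have "card (B - ?U) = card B - card ?U" using fB by (intro card_Diff_subset) auto
  then have "D2 * (card B - K) \<le> D2 * card (B - ?U)"
    using U by (intro mult_le_mono2) simp
  also have "\<dots> = (\<Sum>v\<in>B - ?U. D2)" by simp
  also have "\<dots> \<le> (\<Sum>v\<in>B - ?U. edge_deg (set F) v)" by (intro sum_mono) auto
  also have "\<dots> \<le> (\<Sum>v\<in>B. edge_deg (set F) v)" using fB by (intro sum_mono2) auto
  finally show "D2 * (card B - K) \<le> (\<Sum>v\<in>B. edge_deg (set F) v)" .
qed (use assms in auto)

text \<open>The witness \<open>x\<close> is the state after the first phase. Freshness of the greedy
  edges makes their set disjoint from \<open>gs\<close>.\<close>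

lemma robust_run:
  assumes closed: "init A r \<in> states s"
      "\<And>x e. x \<in> states s \<Longrightarrow> e \<in> edges_on n \<Longrightarrow> update A r x e \<in> states s"
    and gs: "valid_stream n D1 gs" "gs \<noteq> []"
    and proper: "all_proper n K A (adv_of (next_token gs)) r"
  defines "J \<equiv> Suc (card (edges_on n))"
  shows "\<exists>x\<in>states s. saturating (set (snd (greedy_run A r x J))) \<and>
           set (snd (greedy_run A r x J)) \<inter> set gs = {}"
proof -
  let ?I = "interaction A (adv_of (next_token gs)) r"
  have valid_gs: "valid_stream n L gs"
    using gs(1) degs by (auto simp: valid_stream_def intro: order_trans)
  \<comment> \<open>First phase: the stream follows \<open>gs\<close>. Before the first token there
    is no output, hence the guard \<open>i > 0\<close>.\<close>
  have alice: "\<exists>x cs. ?I i = (x, take i gs, cs) \<and> x \<in> states s \<and> length cs = i \<and>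
      (i > 0 \<longrightarrow> last cs = query A r x)" if "i \<le> length gs" for i
    using that
  proof (induction i)
    case 0
    then show ?case using closed(1) by simp
  next
    case (Suc i)
    then obtain x cs where i: "?I i = (x, take i gs, cs)" "x \<in> states s" "length cs = i" by auto
    have tk: "take (Suc i) gs = take i gs @ [gs ! i]"
      using Suc.prems by (simp add: take_Suc_conv_app_nth)
    have "valid_stream n L (take (Suc i) gs)"
      using valid_gs valid_stream_prefix[of n L "take (Suc i) gs" "drop (Suc i) gs"] by simp
    then have "next_token gs (take i gs) cs = Some (gs ! i)"
      using Suc.prems by (simp add: next_token_def tk)
    moreover have "gs ! i \<in> edges_on n"
      using gs(1) Suc.prems by (auto simp: valid_stream_def)
    ultimately show ?case using interaction_adv_of_Suc[OF i(1)] i closed(2) tk by simp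
  qed
  from alice[of "length gs"] gs(2) obtain x where x: "x \<in> states s" and
    "\<exists>cs. ?I (length gs) = (x, gs, cs) \<and> length cs = length gs \<and> last cs = query A r x" by auto
  \<comment> \<open>Second phase: the real interaction and \<open>greedy_run\<close> from
    \<open>x\<close> go through the same states and greedy edges.\<close>
  then have bob: "\<exists>y F cs. greedy_run A r x j = (y, F) \<and> ?I (length gs + j) = (y, gs @ F, cs) \<and>
      cs \<noteq> [] \<and> last cs = query A r y \<and> valid_stream n L (gs @ F) \<and>
      (\<forall>e\<in>set F. card e = 2 \<and> (\<exists>B\<in>\<B>. e \<subseteq> B)) \<and> (\<forall>v. edge_deg (set F) v \<le> D2)" for j
  proof (induction j)
    case 0
    then show ?case using gs(2) valid_gs by auto
  next
    case (Suc j)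
    then obtain y F cs where j: "greedy_run A r x j = (y, F)" "?I (length gs + j) = (y, gs @ F, cs)"
      "cs \<noteq> []" "last cs = query A r y" "valid_stream n L (gs @ F)"
      "\<forall>e\<in>set F. card e = 2 \<and> (\<exists>B\<in>\<B>. e \<subseteq> B)" "\<forall>v. edge_deg (set F) v \<le> D2" by auto
    have proper_now: "proper_coloring n K (set (gs @ F)) (query A r y)"
      using all_proper_last[OF proper j(2,3)] j(4) by simp
    show ?case
    proof (cases "greedy F (query A r y)")
      case None
      then have "next_token gs (gs @ F) cs = None" using j by (simp add: next_token_def)
      then show ?thesis using None j interaction_adv_of_Suc[OF j(2)] by simp
    next
      case (Some e)
      from greedy_Some[OF Some] obtain B u v where e: "B \<in> \<B>" "u \<in> B" "v \<in> B" "u \<noteq> v" "e = {u, v}"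
        "query A r y u = query A r y v" "edge_deg (set F) u < D2" "edge_deg (set F) v < D2"
        by (auto simp: candidate_def)
      have uv: "u \<in> {1..n}" "v \<in> {1..n}" using e(2,3) blocks(2)[OF e(1)] by auto
      \<comment> \<open>The endpoints share a color in a coloring that is proper for the edges of
        both phases.\<close>
      have fresh: "e \<notin> set (gs @ F)"
        using proper_now uv e(4-6) unfolding proper_coloring_def by blast
      have eon: "e \<in> edges_on n" using e uv by (auto simp: edges_on_def)
      have degF: "edge_deg (set (F @ [e])) w \<le> D2" for w
        using fresh j(7) e(5,7,8) edge_deg_insert[of "set F" e w] by auto
      have "valid_stream n L (gs @ F @ [e])"
        unfolding valid_stream_def
      proof (intro conjI ballI)
        fix w assume w: "w \<in> {1..n}"
        have "card {e' \<in> set (gs @ F @ [e]). w \<in> e'} \<le> edge_deg (set gs) w + edge_deg (set (F @ [e])) w"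
          using edge_deg_Un_le[of "set gs" "set (F @ [e])" w] by (simp add: edge_deg_def)
        also have "\<dots> \<le> D1 + D2"
          using gs(1) w degF[of w] by (intro add_mono) (auto simp: valid_stream_def edge_deg_def)
        finally show "card {e' \<in> set (gs @ F @ [e]). w \<in> e'} \<le> L" using degs by simp
      qed (use fresh eon j(5) in \<open>auto simp: valid_stream_def\<close>)
      moreover from this have "next_token gs (gs @ F) cs = Some e"
        using Some j by (simp add: next_token_def)
      moreover have "card e = 2" "e \<subseteq> B" using e by auto
      ultimately show ?thesis
        using Some j interaction_adv_of_Suc[OF j(2)] degF e(1) by auto
    qed
  qed
  from bob[of J] obtain y F cs where J: "greedy_run A r x J = (y, F)" "?I (length gs + J) = (y, gs @ F, cs)"
    "cs \<noteq> []" "last cs = query A r y" "valid_stream n L (gs @ F)"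
    "\<forall>e\<in>set F. card e = 2 \<and> (\<exists>B\<in>\<B>. e \<subseteq> B)" "\<forall>v. edge_deg (set F) v \<le> D2" by auto
  \<comment> \<open>Without getting stuck, \<open>J\<close> rounds would insert \<open>J\<close>
    distinct edges, one more than exist.\<close>
  have "length F = card (set F)" using J(5) by (simp add: valid_stream_def distinct_card)
  also have "\<dots> \<le> card (edges_on n)"
    using J(5) finite_edges_on by (intro card_mono) (auto simp: valid_stream_def)
  finally have "length F \<noteq> J" by (simp add: J_def)
  then have stuck: "greedy F (query A r y) = None" using length_greedy_run[OF J(1)] by blast
  have "proper_coloring n K (set (gs @ F)) (query A r y)"
    using all_proper_last[OF proper J(2,3)] J(4) by simp
  then have "saturating (set F)" using stuck J by (intro saturating_if_stuck)
  moreover have "set F \<inter> set gs = {}" using J(5) by (auto simp: valid_stream_def)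
  ultimately show ?thesis using x J(1) by (intro bexI[of _ x]) simp_all
qed

section \<open>Random permutation graphs\<close>

text \<open>The sample space of the random graph; uniform probabilities are handled by
  counting.\<close>

definition perm_families :: "nat \<Rightarrow> (nat set \<times> nat \<Rightarrow> nat \<Rightarrow> nat) set" where
  "perm_families q = (\<Pi>\<^sub>E (B, j)\<in>\<B> \<times> {..<q}. {\<sigma>. \<sigma> permutes B})"

definition perm_graph :: "nat \<Rightarrow> (nat set \<times> nat \<Rightarrow> nat \<Rightarrow> nat) \<Rightarrow> edge set" where
  "perm_graph q \<omega> = {{v, \<omega> (B, j) v} | B j v. B \<in> \<B> \<and> j < q \<and> v \<in> B \<and> \<omega> (B, j) v \<noteq> v}"

lemma perm_families_permutes:
  "\<omega> \<in> perm_families q \<Longrightarrow> B \<in> \<B> \<Longrightarrow> j < q \<Longrightarrow> \<omega> (B, j) permutes B"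
  unfolding perm_families_def by (drule PiE_mem[of _ _ _ "(B, j)"]) auto

lemma finite_blocks: "finite \<B>"
  using blocks(2) by (intro finite_subset[of \<B> "Pow {1..n}"]) auto

lemma finite_block: "B \<in> \<B> \<Longrightarrow> finite B"
  using blocks(2) finite_subset by blast

lemma finite_perm_families: "finite (perm_families q)"
  unfolding perm_families_def
  using finite_blocks by (intro finite_PiE) (auto simp: finite_block finite_permutations)

lemma block_unique: "B \<in> \<B> \<Longrightarrow> B' \<in> \<B> \<Longrightarrow> v \<in> B \<Longrightarrow> v \<in> B' \<Longrightarrow> B = B'"
  using disjointD[OF blocks(1)] by blast

lemma perm_graph_edges:
  assumes "\<omega> \<in> perm_families q"
  shows "perm_graph q \<omega> \<subseteq> edges_on n"
proof
  fix e assume "e \<in> perm_graph q \<omega>"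
  then obtain B j v where e: "e = {v, \<omega> (B, j) v}" "B \<in> \<B>" "j < q" "v \<in> B" "\<omega> (B, j) v \<noteq> v"
    by (auto simp: perm_graph_def)
  then have "\<omega> (B, j) v \<in> B" using perm_families_permutes[OF assms] by (simp add: permutes_in_image)
  then show "e \<in> edges_on n" using e blocks(2)[of B] by (auto simp: edges_on_def)
qed

text \<open>Each permutation contributes at most two edges at \<open>v\<close>, one to its image and
  one to its preimage.\<close>

lemma perm_graph_deg:
  assumes "\<omega> \<in> perm_families q"
  shows "edge_deg (perm_graph q \<omega>) v \<le> 2 * q"
proof (cases "\<exists>B\<in>\<B>. v \<in> B")
  case True
  then obtain B where B: "B \<in> \<B>" "v \<in> B" by blast
  let ?S1 = "(\<lambda>j. {v, \<omega> (B, j) v}) ` {..<q}" and ?S2 = "(\<lambda>j. {v, inv (\<omega> (B, j)) v}) ` {..<q}"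
  have "{e \<in> perm_graph q \<omega>. v \<in> e} \<subseteq> ?S1 \<union> ?S2"
  proof
    fix e assume "e \<in> {e \<in> perm_graph q \<omega>. v \<in> e}"
    then obtain B' j u where e: "e = {u, \<omega> (B', j) u}" "B' \<in> \<B>" "j < q" "u \<in> B'" "v \<in> e"
      by (auto simp: perm_graph_def)
    have p: "\<omega> (B', j) permutes B'" using perm_families_permutes[OF assms] e by auto
    then have "v \<in> B'" using e by (auto simp: permutes_in_image)
    then have [simp]: "B' = B" using B e block_unique by blast
    show "e \<in> ?S1 \<union> ?S2"
    proof (cases "v = u")
      case False
      then have "v = \<omega> (B, j) u" using e by auto
      then have "u = inv (\<omega> (B, j)) v" using p by (simp add: permutes_inverses)
      then have "e = {v, inv (\<omega> (B, j)) v}" using e \<open>v = \<omega> (B, j) u\<close> by auto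
      then show ?thesis using e by auto
    qed (use e in auto)
  qed
  then have "edge_deg (perm_graph q \<omega>) v \<le> card (?S1 \<union> ?S2)"
    unfolding edge_deg_def by (intro card_mono) auto
  also have "\<dots> \<le> card ?S1 + card ?S2" by (rule card_Un_le)
  also have "\<dots> \<le> q + q" 
    using card_image_le[of "{..<q}" "\<lambda>j. {v, \<omega> (B, j) v}"]
      card_image_le[of "{..<q}" "\<lambda>j. {v, inv (\<omega> (B, j)) v}"] by (intro add_mono) auto
  finally show ?thesis by simp
next
  case False
  have "{e \<in> perm_graph q \<omega>. v \<in> e} = {}"
    using False perm_families_permutes[OF assms]
    by (fastforce simp: perm_graph_def permutes_in_image)
  then show ?thesis unfolding edge_deg_def by (simp only: card.empty)
qed

text \<open>Edges of \<open>F\<close> stay inside blocks, so the values forbidden for a permutation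
  at \<open>v\<close> are counted by the degree.\<close>

lemma card_neighbours:
  assumes "saturating F" "B \<in> \<B>" "v \<in> B"
  shows "card {u \<in> B. {v, u} \<in> F} = edge_deg F v"
  unfolding edge_deg_def
proof (rule bij_betw_same_card[of "\<lambda>u. {v, u}"], rule bij_betw_imageI)
  show "inj_on (\<lambda>u. {v, u}) {u \<in> B. {v, u} \<in> F}" by (auto simp: inj_on_def doubleton_eq_iff)
  show "(\<lambda>u. {v, u}) ` {u \<in> B. {v, u} \<in> F} = {e \<in> F. v \<in> e}"
  proof (intro equalityI subsetI)
    fix e assume e: "e \<in> {e \<in> F. v \<in> e}"
    then have "card e = 2" using assms(1) by (auto simp: saturating_def)
    then obtain u where u: "e = {v, u}"
      using e by (auto simp: card_2_iff)
    obtain B' where "B' \<in> \<B>" "e \<subseteq> B'" using e assms(1) by (auto simp: saturating_def)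
    then have "B' = B" using u assms block_unique by auto
    then show "e \<in> (\<lambda>u. {v, u}) ` {u \<in> B. {v, u} \<in> F}" using u e \<open>e \<subseteq> B'\<close> by auto
  qed auto
qed

text \<open>The \<open>card \<B> * q\<close> permutations are chosen independently, so the bounds
  for single permutations multiply.\<close>

lemma card_avoiding_families:
  assumes F: "saturating F" and N: "\<And>B. B \<in> \<B> \<Longrightarrow> card B = N" and "D2 + 70 \<le> N"
  shows "real (card {\<omega> \<in> perm_families q. perm_graph q \<omega> \<inter> F = {}})
    \<le> real (card (perm_families q)) * exp (- (19/20 * real (D2 * (N - K)) / real N) * real (card \<B> * q))"
    (is "_ \<le> _ * exp (- ?c * _)")
proof -
  let ?Q = "\<lambda>(B, j). {\<sigma>. \<sigma> permutes B \<and> (\<forall>v\<in>B. {v, \<sigma> v} \<notin> F)}"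
  have "{\<omega> \<in> perm_families q. perm_graph q \<omega> \<inter> F = {}} \<subseteq> Pi\<^sub>E (\<B> \<times> {..<q :: nat}) ?Q"
  proof
    fix \<omega> assume \<omega>: "\<omega> \<in> {\<omega> \<in> perm_families q. perm_graph q \<omega> \<inter> F = {}}"
    have "{v, \<omega> (B, j) v} \<notin> F" if "B \<in> \<B>" "j < q" "v \<in> B" for B j v
    proof (cases "\<omega> (B, j) v = v")
      \<comment> \<open>A fixed point yields a singleton, whereas the elements of \<open>F\<close>
        have two vertices.\<close>
      case True
      then show ?thesis using F by (auto simp: saturating_def)
    next
      case False
      then have "{v, \<omega> (B, j) v} \<in> perm_graph q \<omega>" using that by (auto simp: perm_graph_def)
      then show ?thesis using \<omega> by auto
    qed
    then show "\<omega> \<in> Pi\<^sub>E (\<B> \<times> {..<q}) ?Q"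
      using \<omega> by (auto simp: perm_families_def PiE_iff)
  qed
  moreover have "finite (?Q p)" if "p \<in> \<B> \<times> {..<q :: nat}" for p
    using that by (auto intro!: finite_subset[OF _ finite_permutations[OF finite_block]])
  ultimately have "card {\<omega> \<in> perm_families q. perm_graph q \<omega> \<inter> F = {}} \<le> card (Pi\<^sub>E (\<B> \<times> {..<q :: nat}) ?Q)"
    using finite_blocks by (intro card_mono finite_PiE) auto
  also have "\<dots> = (\<Prod>p\<in>\<B> \<times> {..<q :: nat}. card (?Q p))"
    using finite_blocks by (intro card_PiE) auto
  finally have "real (card {\<omega> \<in> perm_families q. perm_graph q \<omega> \<inter> F = {}})
      \<le> real (\<Prod>p\<in>\<B> \<times> {..<q :: nat}. card (?Q p))"
    by (rule of_nat_mono)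
  also have "\<dots> = (\<Prod>p\<in>\<B> \<times> {..<q :: nat}. real (card (?Q p)))"
    by (rule of_nat_prod)
  also have "\<dots> \<le> (\<Prod>p\<in>\<B> \<times> {..<q :: nat}. fact N * exp (- ?c))"
  proof (rule prod_mono)
    fix p assume "p \<in> \<B> \<times> {..<q :: nat}"
    then obtain B j where p: "p = (B, j)" and B: "B \<in> \<B>" by auto
    have "real (card (?Q (B, j)))
        \<le> fact (card B) * exp (- (19/20 * real (\<Sum>v\<in>B. edge_deg F v) / real (card B)))"
      unfolding prod.case
    proof (rule card_permutations_avoiding_le)
      fix v assume "v \<in> B"
      show "edge_deg F v + 70 \<le> card B"
      proof -
        have "edge_deg F v \<le> D2" using F by (simp add: saturating_def)
        then show ?thesis using N[OF B] assms(3) by simp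
      qed
    qed (use B finite_block card_neighbours[OF F] in auto)
    also have "\<dots> \<le> fact N * exp (- ?c)"
    proof -
      have "real (D2 * (N - K)) \<le> real (\<Sum>v\<in>B. edge_deg F v)"
        using F B N[OF B] unfolding saturating_def of_nat_le_iff by blast
      then have "?c \<le> 19/20 * real (\<Sum>v\<in>B. edge_deg F v) / real N"
        by (intro divide_right_mono mult_left_mono) auto
      then show ?thesis unfolding N[OF B] by (intro mult_left_mono) auto
    qed
    finally show "0 \<le> real (card (?Q p)) \<and> real (card (?Q p)) \<le> fact N * exp (- ?c)"
      unfolding p by simp
  qed
  also have "\<dots> = fact N ^ (card \<B> * q) * exp (- ?c * real (card \<B> * q))"
    by (simp add: power_mult_distrib card_cartesian_product exp_of_nat2_mult[symmetric] del: of_nat_mult)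
  also have "fact N ^ (card \<B> * q) = real (card (perm_families q))"
  proof -
    have "card (perm_families q) = (\<Prod>p\<in>\<B> \<times> {..<q}. card (case p of (B, j) \<Rightarrow> {\<sigma>. \<sigma> permutes B}))"
      unfolding perm_families_def using finite_blocks by (intro card_PiE) auto
    also have "\<dots> = (\<Prod>p\<in>\<B> \<times> {..<q}. fact N)"
      by (intro prod.cong) (auto simp: N finite_block intro!: card_permutations)
    finally show ?thesis by (simp add: card_cartesian_product)
  qed
  finally show ?thesis .
qed

text \<open>Averaging yields one random string for which at least a fraction \<open>p\<close> of the
  families succeeds. Each of these avoids \<open>F x\<close> for some state \<open>x\<close>, and a
  union bound over the states finishes.\<close>

theorem state_space_lower_bound:
  assumes alg: "streaming_algorithm M n s A" and robust: "robust_coloring M n L K p A" and "p > 0"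
    and N: "\<And>B. B \<in> \<B> \<Longrightarrow> card B = N" and "D2 + 70 \<le> N"
    and D1: "D1 = 2 * q" "q > 0" and n: "n \<ge> 2"
  shows "p \<le> 2 ^ s * exp (- (19/20 * real (D2 * (N - K)) / real N) * real (card \<B> * q))"
    (is "_ \<le> _ * ?x")
proof -
  interpret prob_space M using alg by (simp add: streaming_algorithm_def)
  let ?\<Omega> = "perm_families q"
  \<comment> \<open>The greedy phase needs a coloring to start from, so the first phase must not be empty.\<close>
  define G where "G \<omega> = (if perm_graph q \<omega> = {} then {{1, 2}} else perm_graph q \<omega>)" for \<omega>
  have "\<exists>gs. valid_stream n D1 gs \<and> gs \<noteq> [] \<and> perm_graph q \<omega> \<subseteq> set gs" if \<omega>: "\<omega> \<in> ?\<Omega>" for \<omega>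
  proof -
    have G: "G \<omega> \<subseteq> edges_on n" "G \<omega> \<noteq> {}" "perm_graph q \<omega> \<subseteq> G \<omega>"
      using perm_graph_edges[OF \<omega>] n by (auto simp: G_def edges_on_def)
    have deg: "edge_deg (G \<omega>) v \<le> D1" for v
    proof (cases "perm_graph q \<omega> = {}")
      case True
      have "edge_deg {{1, 2}} v \<le> card {{1, 2 :: nat}}"
        unfolding edge_deg_def by (rule card_mono) auto
      then show ?thesis using True D1 by (simp add: G_def)
    next
      case False
      then show ?thesis using perm_graph_deg[OF \<omega>, of v] D1 by (simp add: G_def)
    qed
    obtain gs where "set gs = G \<omega>" "distinct gs"
      using finite_distinct_list[OF finite_subset[OF G(1) finite_edges_on]] by blast
    then show ?thesis using G deg by (intro exI[of _ gs]) (auto simp: valid_stream_def edge_deg_def)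
  qed
  then obtain gs where gs: "\<And>\<omega>. \<omega> \<in> ?\<Omega> \<Longrightarrow> valid_stream n D1 (gs \<omega>)" "\<And>\<omega>. \<omega> \<in> ?\<Omega> \<Longrightarrow> gs \<omega> \<noteq> []"
    "\<And>\<omega>. \<omega> \<in> ?\<Omega> \<Longrightarrow> perm_graph q \<omega> \<subseteq> set (gs \<omega>)" by metis
  define S where "S \<omega> = {r \<in> space M. all_proper n K A (adv_of (next_token (gs \<omega>))) r}" for \<omega>
  have Sp: "p \<le> prob (S \<omega>)" for \<omega>
    using robust valid_adversary_next_token by (auto simp: robust_coloring_def S_def)
  \<comment> \<open>A set outside the sigma-algebra has measure 0 by convention, which
    \<open>p > 0\<close> excludes.\<close>
  have [measurable]: "S \<omega> \<in> events" for \<omega>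
    using Sp[of \<omega>] \<open>p > 0\<close> measure_notin_sets[of "S \<omega>" M] by fastforce
  have exp: "real (card ?\<Omega>) * p \<le> expectation (\<lambda>r. \<Sum>\<omega>\<in>?\<Omega>. indicator (S \<omega>) r)"
  proof -
    have "real (card ?\<Omega>) * p \<le> (\<Sum>\<omega>\<in>?\<Omega>. prob (S \<omega>))"
      using Sp by (intro sum_bounded_below)
    also have "\<dots> = (\<Sum>\<omega>\<in>?\<Omega>. expectation (indicator (S \<omega>)))" by simp
    also have "\<dots> = expectation (\<lambda>r. \<Sum>\<omega>\<in>?\<Omega>. indicator (S \<omega>) r)"
      by (intro Bochner_Integration.integral_sum[symmetric]) (simp add: less_top[symmetric])
    finally show ?thesis .
  qed
  have "\<exists>r\<in>space M. real (card ?\<Omega>) * p \<le> (\<Sum>\<omega>\<in>?\<Omega>. indicator (S \<omega>) r)"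
  proof (rule ccontr)
    assume "\<not> ?thesis"
    then have "expectation (\<lambda>r. \<Sum>\<omega>\<in>?\<Omega>. indicator (S \<omega>) r) < real (card ?\<Omega>) * p"
      by (intro expectation_less Bochner_Integration.integrable_sum)
         (auto intro!: AE_I2 simp: not_le less_top[symmetric])
    then show False using exp by simp
  qed
  then obtain r where r: "r \<in> space M" "real (card ?\<Omega>) * p \<le> (\<Sum>\<omega>\<in>?\<Omega>. indicator (S \<omega>) r)" by blast
  have closed: "init A r \<in> states s"
    "\<And>x e. x \<in> states s \<Longrightarrow> e \<in> edges_on n \<Longrightarrow> update A r x e \<in> states s"
  proof -
    show "init A r \<in> states s"
      using alg r(1) measurable_space[of "init A" M "count_space (states s)" r]
      by (simp add: streaming_algorithm_def)
    show "update A r x e \<in> states s" if "x \<in> states s" "e \<in> edges_on n" for x e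
      using alg r(1) that measurable_space[of "\<lambda>r. update A r x e" M "count_space (states s)" r]
      by (simp add: streaming_algorithm_def)
  qed
  define F where "F x = set (snd (greedy_run A r x (Suc (card (edges_on n)))))" for x
  let ?X = "{x \<in> states s. saturating (F x)}"
  have states: "finite (states s)" "card (states s) = 2 ^ s"
    using card_lists_length_eq[of "UNIV :: bool set" s] finite_lists_length_eq[of "UNIV :: bool set" s]
    by (auto simp: states_def)
  have "{\<omega> \<in> ?\<Omega>. r \<in> S \<omega>} \<subseteq> (\<Union>x\<in>?X. {\<omega> \<in> ?\<Omega>. perm_graph q \<omega> \<inter> F x = {}})"
  proof
    fix \<omega> assume "\<omega> \<in> {\<omega> \<in> ?\<Omega>. r \<in> S \<omega>}"
    then have \<omega>: "\<omega> \<in> ?\<Omega>" "all_proper n K A (adv_of (next_token (gs \<omega>))) r" by (auto simp: S_def)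
    then obtain x where "x \<in> states s" "saturating (F x)" "F x \<inter> set (gs \<omega>) = {}"
      using robust_run[OF closed gs(1,2)] unfolding F_def by blast
    then show "\<omega> \<in> (\<Union>x\<in>?X. {\<omega> \<in> ?\<Omega>. perm_graph q \<omega> \<inter> F x = {}})" using gs(3)[OF \<omega>(1)] \<omega>(1) by blast
  qed
  then have "card {\<omega> \<in> ?\<Omega>. r \<in> S \<omega>} \<le> card (\<Union>x\<in>?X. {\<omega> \<in> ?\<Omega>. perm_graph q \<omega> \<inter> F x = {}})"
    using states finite_perm_families by (intro card_mono) auto
  also have "\<dots> \<le> (\<Sum>x\<in>?X. card {\<omega> \<in> ?\<Omega>. perm_graph q \<omega> \<inter> F x = {}})"
    using states by (intro card_UN_le) auto
  finally have "real (card {\<omega> \<in> ?\<Omega>. r \<in> S \<omega>})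
      \<le> real (\<Sum>x\<in>?X. card {\<omega> \<in> ?\<Omega>. perm_graph q \<omega> \<inter> F x = {}})"
    by (rule of_nat_mono)
  also have "\<dots> = (\<Sum>x\<in>?X. real (card {\<omega> \<in> ?\<Omega>. perm_graph q \<omega> \<inter> F x = {}}))"
    by (rule of_nat_sum)
  also have "\<dots> \<le> (\<Sum>x\<in>?X. real (card ?\<Omega>) * ?x)"
    using N assms(5) by (intro sum_mono card_avoiding_families) auto
  also have "\<dots> = real (card ?X) * (real (card ?\<Omega>) * ?x)" by simp
  also have "\<dots> \<le> 2 ^ s * (real (card ?\<Omega>) * ?x)"
  proof (rule mult_right_mono)
    have "card ?X \<le> card (states s)" using states by (intro card_mono) auto
    then have "real (card ?X) \<le> real (2 ^ s)" unfolding states by (rule of_nat_mono)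
    then show "real (card ?X) \<le> 2 ^ s" by simp
  qed simp
  also have "real (card {\<omega> \<in> ?\<Omega>. r \<in> S \<omega>}) = (\<Sum>\<omega>\<in>?\<Omega>. indicator (S \<omega>) r)"
  proof -
    have "(\<Sum>\<omega>\<in>?\<Omega>. indicator (S \<omega>) r) = (\<Sum>\<omega>\<in>?\<Omega>. of_bool (r \<in> S \<omega>) :: real)"
      by (simp add: indicator_def)
    also have "\<dots> = real (card {\<omega> \<in> ?\<Omega>. r \<in> S \<omega>})"
      using finite_perm_families by (simp add: Int_def)
    finally show ?thesis by simp
  qed
  finally have "real (card ?\<Omega>) * p \<le> real (card ?\<Omega>) * (2 ^ s * ?x)"
    using r(2) by (simp add: mult_ac)
  moreover have "card ?\<Omega> > 0"
    using finite_perm_families by (auto simp: card_gt_0_iff perm_families_def PiE_eq_empty_iff intro: permutes_id)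
  ultimately show ?thesis by simp
qed
end

section \<open>The space bound\<close>

text \<open>Bootstrapping: \<open>ln 2 \<ge> 2/3\<close> turns \<open>4 n \<ge> 2 ^ m\<close> into
  \<open>L \<ge> 8 m\<close>, and \<open>n \<ge> 2 L + 2\<close> then permits a larger
  \<open>m\<close>, through 3, 7, 8 and 9.\<close>

lemma degree_bound_ge_72:
  fixes L n K :: nat
  assumes "2 * K \<le> n" "L + 1 \<le> K" "real L \<ge> 12 * ln (4 * real n)"
  shows "L \<ge> 72"
proof -
  have step: "8 * m \<le> L" if "2 ^ m \<le> 4 * n" for m
  proof -
    have "real m * (2/3) \<le> real m * ln 2"
      using ln2_ge_two_thirds by (intro mult_left_mono) auto
    also have "\<dots> = ln (2 ^ m)" by (simp add: ln_realpow)
    also have "\<dots> \<le> ln (4 * real n)"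
    proof (rule ln_mono)
      have "real (2 ^ m) \<le> real (4 * n)" using that by (rule of_nat_mono)
      then show "2 ^ m \<le> 4 * real n" by simp
    qed simp
    finally have "8 * real m \<le> real L" using assms(3) by simp
    then show ?thesis by linarith
  qed
  have n: "2 * L + 2 \<le> n" using assms by simp
  have "24 \<le> L" using step[of 3] n by simp
  then have "56 \<le> L" using step[of 7] n by simp
  then have "64 \<le> L" using step[of 8] n by simp
  then show ?thesis using step[of 9] n by simp
qed

text \<open>The witness is \<open>n / (3 K)\<close> rounded up. If it is 1, the upper bound follows
  from \<open>2 K \<le> n\<close>; otherwise rounding up adds at most
  \<open>3 K < n\<close>.\<close>

lemma block_count_exists:
  fixes n K :: nat
  assumes "K > 0" "2 * K \<le> n"
  obtains k where "k > 0" "n \<le> 3 * K * k" "3 * K * k \<le> 2 * n"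
proof
  let ?m = "(n - 1) div (3 * K)"
  have "3 * K * ?m + (n - 1) mod (3 * K) = n - 1" by simp
  moreover have "(n - 1) mod (3 * K) < 3 * K" using assms by simp
  moreover have "3 * K \<le> 3 * K * ?m" if "?m > 0" using that by simp
  moreover have "3 * K * Suc ?m = 3 * K * ?m + 3 * K" by simp
  ultimately show "n \<le> 3 * K * Suc ?m" "3 * K * Suc ?m \<le> 2 * n"
    using assms by (linarith, cases "?m = 0") (simp, linarith)
qed simp

text \<open>\<open>N^2 / ((N - K) K)\<close> is convex in \<open>N > K\<close> and equals
  \<open>9/2\<close> at both \<open>N = 3/2 K\<close> and \<open>N = 3 K\<close>. The slack up to
  \<open>4.74\<close> absorbs the rounding terms once \<open>K \<ge> 20\<close>.\<close>

lemma block_size_quadratic: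
  fixes N K :: real
  assumes "3 * K - 1 \<le> 2 * N" "N \<le> 3 * K" "K \<ge> 20"
  shows "N * (N + 1) \<le> 474/100 * (N - K) * K"
proof -
  have "0 \<le> (2 * N - (3 * K - 1)) * (3 * K - N)"
    using assms by (intro mult_nonneg_nonneg) auto
  moreover have "0 \<le> (24/100 * K - 1/2) * (2 * N - (3 * K - 1))"
    using assms by (intro mult_nonneg_nonneg) auto
  moreover have "0 \<le> K * (12/100 * K - 237/100)" using assms by (intro mult_nonneg_nonneg) auto
  moreover have "474/100 * (N - K) * K - N * (N + 1) = 1/2 * ((2 * N - (3 * K - 1)) * (3 * K - N))
      + 1/2 * ((24/100 * K - 1/2) * (2 * N - (3 * K - 1))) + K * (12/100 * K - 237/100) + 1/4"
    by (simp add: field_simps)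
  ultimately show ?thesis by linarith
qed

theorem theorem4p3:
  fixes M :: "'r measure" and A :: "'r stream_alg" and L n K s :: nat
  assumes "2 * K \<le> n"
    and "L + 1 \<le> K"
    and "real L \<ge> 12 * ln (4 * real n)"
    and "streaming_algorithm M n s A"
    and "robust_coloring M n L K (1/4) A"
  shows "real s \<ge> 1 / (40 * ln 2) * (real n * (real L)\<^sup>2 / real K) - 3"
proof -
  have L: "L \<ge> 72" using assms(1-3) by (rule degree_bound_ge_72)
  obtain k where k: "k > 0" "n \<le> 3 * K * k" "3 * K * k \<le> 2 * n"
    using block_count_exists[of K n] assms(1,2) by auto
  define N where "N = n div k"
  \<comment> \<open>A value near \<open>L / 4\<close> maximizes \<open>q (L - 2 q)\<close>, the
    product that enters the exponent.\<close>
  define q where "q = L div 4"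
  define D2 where "D2 = L - 2 * q"
  define \<B> where "\<B> = (\<lambda>b. {b * N + 1..b * N + N}) ` {..<k}"
  have Nk: "N * k \<le> n" "n < (N + 1) * k"
    using k(1) by (auto simp: N_def dividend_less_div_times)
  have N_le: "N \<le> 3 * K"
  proof -
    have "N * k \<le> (3 * K) * k" using Nk(1) k(2) by (rule order_trans)
    then show ?thesis using k(1) by simp
  qed
  have N_ge: "3 * K < 2 * (N + 1)"
  proof -
    have "3 * K * k < (2 * (N + 1)) * k" using Nk(2) k(3) by (simp add: mult.assoc)
    then show ?thesis unfolding mult_less_cancel2 by blast
  qed
  have Lq: "L = 4 * q + L mod 4" "L mod 4 \<le> 3" by (auto simp: q_def)
  have N_D2: "D2 + 70 \<le> N" "K \<le> N" "N > 0" 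
  proof -
    \<comment> \<open>With \<open>2 N \<ge> 3 K - 1 \<ge> 3 L + 2\<close> this gives
      \<open>2 (N - D2) \<ge> 2 L - 1\<close>, which is enough as \<open>L \<ge> 72\<close>.\<close>
    have "2 * D2 \<le> L + 3" using Lq unfolding D2_def by linarith
    then show "D2 + 70 \<le> N" using N_ge assms(2) L by presburger
    show "K \<le> N" "N > 0" using N_ge assms(2) L by presburger+
  qed
  have block_inj: "b = b'"
    if "v \<in> {b * N + 1..b * N + N}" "v \<in> {b' * N + 1..b' * N + N}" for b b' v
  proof -
    have "(v - 1) div N = b" if "v \<in> {b * N + 1..b * N + N}" for b
      using that N_D2(3) by (intro div_nat_eqI) (auto simp: mult.commute)
    then show ?thesis using that by metis
  qed
  have card_B: "card \<B> = k"
  proof -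
    have "inj_on (\<lambda>b. {b * N + 1..b * N + N}) {..<k}"
    proof (rule inj_onI)
      fix b b' assume "{b * N + 1..b * N + N} = {b' * N + 1..b' * N + N}"
      then have "b * N + 1 \<in> {b' * N + 1..b' * N + N}" using N_D2(3) by auto
      then show "b = b'" using block_inj[of "b * N + 1" b b'] N_D2(3) by auto
    qed
    then show ?thesis by (simp add: \<B>_def card_image)
  qed
  interpret block_game n L K "2 * q" D2 \<B>
  proof
    show "2 * q + D2 \<le> L" using Lq by (simp add: D2_def)
    show "disjoint \<B>" using block_inj unfolding \<B>_def disjoint_def by blast
    fix B assume "B \<in> \<B>"
    then obtain b where b: "b < k" "B = {b * N + 1..b * N + N}" by (auto simp: \<B>_def)
    have "b * N + N = Suc b * N" by simp
    also have "\<dots> \<le> k * N" using b(1) by (intro mult_le_mono1) auto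
    also have "\<dots> \<le> n" using Nk(1) by (simp add: mult.commute)
    finally show "B \<subseteq> {1..n}" using b by auto
  qed
  define E where "E = 19/20 * real (D2 * (N - K)) / real N * real (k * q)"
  have "1/4 \<le> 2 ^ s * exp (- (19/20 * real (D2 * (N - K)) / real N) * real (card \<B> * q))"
    using assms(4,5) N_D2(1) L assms(1,2)
    by (intro state_space_lower_bound) (auto simp: \<B>_def q_def)
  then have "1/4 \<le> 2 ^ s * exp (- E)" by (simp only: E_def card_B mult_minus_left)
  \<comment> \<open>The success probability \<open>1/4\<close> accounts for the two extra
    bits.\<close>
  then have "exp E \<le> 2 ^ (s + 2)" by (simp add: exp_minus field_simps)
  then have "ln (exp E) \<le> ln (2 ^ (s + 2))" by (intro ln_mono) auto
  also have "\<dots> = real (s + 2) * ln 2" by (rule ln_realpow)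
  finally have E_le: "E \<le> (real s + 2) * ln 2" by (simp add: add.commute)
  \<comment> \<open>With \<open>t = L mod 4\<close> the product is \<open>(L^2 - t^2) / 8\<close>,
    and \<open>t^2 \<le> 9\<close> is below \<open>L^2 / 500\<close> for
    \<open>L \<ge> 72\<close>.\<close>
  have qD2: "998/8000 * (real L)\<^sup>2 \<le> real q * real D2"
  proof -
    define t where "t = real (L mod 4)"
    have t: "real L = 4 * real q + t" "0 \<le> t" "t \<le> 3" "real D2 = 2 * real q + t"
      using Lq by (auto simp: t_def D2_def)
    have "t * t \<le> 3 * 3" using t by (intro mult_mono) auto
    moreover have "72 * 72 \<le> real L * real L" using L by (intro mult_mono) auto
    moreover have "8 * (real q * real D2) = real L * real L - t * t"
      unfolding t by (simp add: algebra_simps)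
    ultimately show ?thesis by (simp add: power2_eq_square)
  qed
  have "real n * real N \<le> 474/100 * (real k * (real N - real K) * real K)"
  proof -
    have "real n \<le> (real N + 1) * real k"
      using Nk(2) by (metis less_imp_le of_nat_1 of_nat_add of_nat_le_iff of_nat_mult)
    then have "real n * real N \<le> real k * (real N * (real N + 1))"
      using mult_right_mono[of "real n" "(real N + 1) * real k" "real N"] by (simp add: mult_ac)
    also have "\<dots> \<le> real k * (474/100 * (real N - real K) * real K)"
      using N_ge N_le L assms(2) by (intro mult_left_mono block_size_quadratic) auto
    finally show ?thesis by (simp add: mult_ac)
  qed
  then have "real n / real K \<le> 474/100 * (real k * (real N - real K) / real N)"
    using N_D2 assms(2) by (simp add: field_simps)
  then have "real n / real K * ((real L)\<^sup>2 / 40) \<le> 474/100 * (real k * (real N - real K) / real N) * ((real L)\<^sup>2 / 40)"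
    by (rule mult_right_mono) simp
  \<comment> \<open>The constants just fit: \<open>4.74 / 40 = 0.1185\<close>, while
    \<open>19/20 * 998/8000 = 0.1185125\<close>.\<close>
  also have "\<dots> \<le> 19/20 * (real k * (real N - real K) / real N) * (998/8000 * (real L)\<^sup>2)"
  proof -
    have "0 \<le> (real k * (real N - real K) / real N) * (real L)\<^sup>2" using N_D2 by simp
    then show ?thesis by simp
  qed
  also have "\<dots> \<le> 19/20 * (real k * (real N - real K) / real N) * (real q * real D2)"
    using qD2 N_D2 by (intro mult_left_mono) auto
  also have "\<dots> = E" using N_D2 by (simp add: E_def of_nat_diff)
  finally have "real n * (real L)\<^sup>2 / real K / 40 \<le> (real s + 2) * ln 2"
    using E_le by simp
  then have "real n * (real L)\<^sup>2 / real K / 40 / ln 2 \<le> (real s + 2) * ln 2 / ln 2"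
    by (rule divide_right_mono) simp
  then show ?thesis by (simp add: mult_ac)
qed

end
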